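(* The class of regular planar graphs on at least 7 vertices is $T_3$-reconstructible.
   Context: Graphs are finite, simple, connected and labeled; two labeled graphs are identical iff they have the same vertex set and edge set. A regular graph is $d$-regular for some $d$ (the degree is not fixed across the class). $T_3(G)$ is the set of 3-element subsets of $V(G)$ inducing a connected subgraph of $G$. A class $\mathcal{C}$ of graphs is $T_3$-reconstructible if any two distinct labeled graphs $G_1 \neq G_2$ in $\mathcal{C}$ satisfy $T_3(G_1) \neq T_3(G_2)$. *)

theory Defs
  imports "HOL-Analysis.Analysis" "Graph_Theory.Graph_Theory"
begin

text \<open>
  A finite simple graph is a \<^locale>\<open>pair_graph\<close>: a finite vertex set \<^const>\<open>pverts\<close> together with a
  symmetric irreflexive relation \<^const>\<open>parcs\<close> on it, the edge \<open>{u, v}\<close> being represented by the two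
  arcs \<open>(u, v)\<close> and \<open>(v, u)\<close>. Two such records are equal iff the labeled graphs have the same vertex
  set and the same edge set.
\<close>

definition edges :: "'a pair_pre_digraph \<Rightarrow> 'a set set" where
  "edges G = {{u, v} | u v. (u, v) \<in> parcs G}"

definition regular :: "'a pair_pre_digraph \<Rightarrow> bool" where
  "regular G \<longleftrightarrow> (\<exists>d. \<forall>v \<in> pverts G. out_degree (with_proj G) v = d)"

text \<open>
  A drawing without crossings: \<open>p\<close> places the vertices at distinct points, and \<open>c e\<close> is a simple arc
  joining the two ends of the edge \<open>e\<close>. An arc contains no vertex other than its ends, and distinct
  arcs meet only in vertices, hence only in common ends. The arcs are indexed by undirected edges
  so that \<open>(u, v)\<close> and \<open>(v, u)\<close> share one arc, traversed in either direction.
\<close>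

definition plane_drawing ::
  "'a pair_pre_digraph \<Rightarrow> ('a \<Rightarrow> complex) \<Rightarrow> ('a set \<Rightarrow> real \<Rightarrow> complex) \<Rightarrow> bool" where
  "plane_drawing G p c \<longleftrightarrow>
     inj_on p (pverts G) \<and>
     (\<forall>e \<in> edges G. Path_Connected.arc (c e) \<and>
        {pathstart (c e), pathfinish (c e)} = p ` e \<and>
        path_image (c e) \<inter> p ` pverts G = p ` e) \<and>
     (\<forall>e \<in> edges G. \<forall>f \<in> edges G. e \<noteq> f \<longrightarrow>
        path_image (c e) \<inter> path_image (c f) \<subseteq> p ` pverts G)"

definition planar :: "'a pair_pre_digraph \<Rightarrow> bool" where
  "planar G \<longleftrightarrow> (\<exists>p c. plane_drawing G p c)"

definition T3 :: "'a pair_pre_digraph \<Rightarrow> 'a set set" where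
  "T3 G = {S. S \<subseteq> pverts G \<and> card S = 3 \<and> Digraph_Component.connected (with_proj G \<restriction> S)}"

definition T3_reconstructible :: "'a pair_pre_digraph set \<Rightarrow> bool" where
  "T3_reconstructible C \<longleftrightarrow> (\<forall>G1 \<in> C. \<forall>G2 \<in> C. G1 \<noteq> G2 \<longrightarrow> T3 G1 \<noteq> T3 G2)"

end

theory Submission
  imports Defs
begin

text \<open>
  Colour a pair of vertices red (blue) if it is an edge of the first (second) graph only. Equality of
  the connected triples says that on every triple both graphs agree on having at least two edges.
  Hence the red pairs form a matching, so do the blue ones, and the ends of a coloured pair are
  joined in the same way to every vertex to which neither is joined by a coloured pair.

  If the degrees agree, a vertex has a red partner iff it has a blue one, so a coloured pair lies on
  an alternating cycle, and every outside vertex is joined to all of the cycle or to none of it. A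
  cycle of length at least 6 has either all its chords or none of them. All chords give a
  \<open>K\<^sub>3\<^sub>,\<^sub>3\<close>. With no chords, or on a 4-cycle, three outside neighbours also give a \<open>K\<^sub>3\<^sub>,\<^sub>3\<close>, and with
  fewer the degree on the cycle is too small compared with that of an outside neighbour, unless
  there are only 6 vertices. If the degrees differ, the red pairs match the vertices of the denser
  graph into adjacent twins, and a maximality argument yields two twins \<open>u, v\<close> with three common
  neighbours that all touch one connected set of further vertices.
  Such a configuration is not planar: the three paths between \<open>u\<close> and \<open>v\<close> form a theta curve, and by
  Janiszewski's theorem no complementary component of a theta curve touches all three arcs.
\<close>

subsection \<open>Theta curves\<close>

lemma theta_not_touched_thrice:
  fixes g1 g2 g3 :: "real \<Rightarrow> complex"
  assumes arcs: "Path_Connected.arc g1" "Path_Connected.arc g2" "Path_Connected.arc g3"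
    and ends: "pathstart g1 = x" "pathstart g2 = x" "pathstart g3 = x"
      "pathfinish g1 = y" "pathfinish g2 = y" "pathfinish g3 = y"
    and disj: "path_image g1 \<inter> path_image g2 = {x, y}" "path_image g1 \<inter> path_image g3 = {x, y}"
      "path_image g2 \<inter> path_image g3 = {x, y}"
    and W: "Topological_Spaces.connected W" "W \<inter> (path_image g1 \<union> path_image g2 \<union> path_image g3) = {}"
    and touch: "closure W \<inter> (path_image g1 - {x, y}) \<noteq> {}"
      "closure W \<inter> (path_image g2 - {x, y}) \<noteq> {}"
      "closure W \<inter> (path_image g3 - {x, y}) \<noteq> {}"
  shows False
proof -
  have side: "\<exists>E. open E \<and> Topological_Spaces.connected E \<and> path_image g - {x, y} \<subseteq> E \<and> E \<inter> C = {}"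
    if g: "Path_Connected.arc g" "pathstart g = x" "pathfinish g = y" and C: "compact C" "path_image g \<inter> C = {x, y}"
      and ne: "closure W \<inter> (path_image g - {x, y}) \<noteq> {}" for g :: "real \<Rightarrow> complex" and C
  proof -
    have con: "Topological_Spaces.connected (path_image g - {x, y})"
      using connected_simple_path_endless[OF arc_imp_simple_path[OF g(1)]] g by simp
    obtain z where z: "z \<in> path_image g - {x, y}" using ne by blast
    let ?E = "connected_component_set (- C) z"
    have "path_image g - {x, y} \<subseteq> ?E"
      using C(2) z con by (intro connected_component_maximal) auto
    moreover have "open ?E" using C(1) by (simp add: open_connected_component open_Compl compact_imp_closed)
    moreover have "?E \<inter> C = {}" using connected_component_subset by fastforce
    ultimately show ?thesis using connected_connected_component by blast
  qed
  have meet: "E \<inter> A \<noteq> {}" if "open E" "P \<subseteq> E" "closure A \<inter> P \<noteq> {}" for A P E :: "complex set"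
    using open_Int_closure_eq_empty[of E A] that by blast
  have same: "connected_component (- C) a b"
    if "open E" "Topological_Spaces.connected E" "P \<subseteq> E" "E \<inter> C = {}"
      "Topological_Spaces.connected A" "A \<inter> C = {}" "closure A \<inter> P \<noteq> {}" "a \<in> A"
      "Topological_Spaces.connected B" "B \<inter> C = {}" "closure B \<inter> P \<noteq> {}" "b \<in> B"
    for A B E P C :: "complex set" and a b
  proof -
    have "Topological_Spaces.connected (E \<union> A)" using connected_Un[of E A] meet[of E P A] that by blast
    then have "Topological_Spaces.connected ((E \<union> A) \<union> B)"
      using connected_Un[of "E \<union> A" B] meet[of E P B] that by blast
    moreover have "(E \<union> A) \<union> B \<subseteq> - C" using that by blast
    ultimately show ?thesis unfolding connected_component_def using that by blast
  qed
  have cmp: "compact (path_image g1)" "compact (path_image g2)" "compact (path_image g3)"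
    using arcs by (auto intro: compact_arc_image)
  have "W \<noteq> {}" using touch(1) by auto
  then obtain w where w: "w \<in> W" by auto
  let ?C = "path_image g2 \<union> path_image g3"
  obtain E where E: "open E" "Topological_Spaces.connected E" "path_image g1 - {x, y} \<subseteq> E" "E \<inter> ?C = {}"
    using side[of g1 ?C] arcs ends disj(1,2) cmp touch(1) compact_Un[of "path_image g2" "path_image g3"]
    by (metis Int_Un_distrib Un_absorb)
  have sp: "simple_path (g2 +++ reversepath g3)"
    using arcs ends disj by (intro simple_path_join_loop) (auto simp: arc_reversepath)
  have pim: "path_image (g2 +++ reversepath g3) = ?C" using ends by (simp add: path_image_join)
  have J: "open (inside ?C)" "Topological_Spaces.connected (inside ?C)" "inside ?C \<noteq> {}" "outside ?C \<noteq> {}"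
    "open (outside ?C)" "Topological_Spaces.connected (outside ?C)"
    "inside ?C \<inter> outside ?C = {}" "inside ?C \<union> outside ?C = - ?C"
    "frontier (inside ?C) = ?C" "frontier (outside ?C) = ?C"
    using Jordan_inside_outside[OF sp] ends unfolding pim by auto
  \<comment> \<open>If \<open>D'\<close> is the side of \<open>g1\<close>, then \<open>W\<close> lies in \<open>D'\<close>, although neither of the other two cycles
    separates it from \<open>D\<close>.\<close>
  have *: False if D: "open D" "Topological_Spaces.connected D" "D \<inter> D' = {}" "D \<union> D' = - ?C"
      "open D'" "D \<noteq> {}" "frontier D = ?C" "path_image g1 - {x, y} \<subseteq> D'" for D D'
  proof -
    obtain d where d: "d \<in> D" using D(6) by auto
    have DC: "D \<inter> path_image g1 = {}" using D(3,4,8) disj(1) by blast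
    have cl: "?C \<subseteq> closure D" using D(7) unfolding frontier_def by blast
    have c2: "connected_component (- (path_image g1 \<union> path_image g3)) d w"
    proof -
      obtain E where E: "open E" "Topological_Spaces.connected E" "path_image g2 - {x, y} \<subseteq> E"
        "E \<inter> (path_image g1 \<union> path_image g3) = {}"
        using side[of g2 "path_image g1 \<union> path_image g3"] arcs ends disj(1,3) cmp touch(2)
          compact_Un[of "path_image g1" "path_image g3"]
        by (metis Int_Un_distrib Int_commute Un_absorb)
      show ?thesis
        using D(2,4) DC d w W touch(2) cl by (intro same[OF E, of D d W w]) blast+
    qed
    have c3: "connected_component (- (path_image g1 \<union> path_image g2)) d w"
    proof -
      obtain E where E: "open E" "Topological_Spaces.connected E" "path_image g3 - {x, y} \<subseteq> E"
        "E \<inter> (path_image g1 \<union> path_image g2) = {}"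
        using side[of g3 "path_image g1 \<union> path_image g2"] arcs ends disj(2,3) cmp touch(3)
          compact_Un[of "path_image g1" "path_image g2"]
        by (metis Int_Un_distrib Int_commute Un_absorb)
      show ?thesis
        using D(2,4) DC d w W touch(3) cl by (intro same[OF E, of D d W w]) blast+
    qed
    have "connected_component (- ((path_image g1 \<union> path_image g3) \<union> (path_image g1 \<union> path_image g2))) d w"
    proof (rule Janiszewski[OF _ _ _ c2 c3])
      have "(path_image g1 \<union> path_image g3) \<inter> (path_image g1 \<union> path_image g2) = path_image g1"
        using disj by auto
      then show "Topological_Spaces.connected ((path_image g1 \<union> path_image g3) \<inter> (path_image g1 \<union> path_image g2))"
        using arcs connected_arc_image by simp
    qed (use cmp in \<open>auto intro: compact_imp_closed\<close>)
    then obtain T where T: "Topological_Spaces.connected T" "T \<subseteq> - ?C" "d \<in> T" "w \<in> T"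
      unfolding connected_component_def by auto
    have "D' \<inter> W \<noteq> {}" using meet[OF D(5,8)] touch(1) by blast
    then have "Topological_Spaces.connected (T \<union> W)" using connected_Un[of T W] T(1,4) w W(1) by blast
    moreover have "T \<union> W \<subseteq> D \<union> D'" using T(2) W(2) D(4) by blast
    ultimately show False using D(1,3,5) T(3) \<open>D' \<inter> W \<noteq> {}\<close> d
      using connectedD[of "T \<union> W" D D'] by blast
  qed
  have "E \<subseteq> inside ?C \<or> E \<subseteq> outside ?C"
    using E(2,4) J(1,5,7,8) connectedD[of E "inside ?C" "outside ?C"] by blast
  then show False
    using *[OF J(5,6) _ _ J(1,4,10)] *[OF J(1,2,7,8,5,3,9)] J(7,8) E(3) by blast
qed

subsection \<open>A nonplanar configuration\<close>

text \<open>
  Contracting the connected set \<open>S\<close> to a vertex would give a \<open>K\<^sub>3\<^sub>,\<^sub>3\<close> with parts \<open>{u, v, S}\<close> and \<open>{a, b, c}\<close>.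
\<close>

definition K33_pattern :: "('a \<times> 'a) set \<Rightarrow> 'a \<Rightarrow> 'a \<Rightarrow> 'a \<Rightarrow> 'a \<Rightarrow> 'a \<Rightarrow> 'a set \<Rightarrow> bool" where
  "K33_pattern R u v a b c S \<longleftrightarrow> distinct [u, v, a, b, c] \<and> S \<inter> {u, v, a, b, c} = {} \<and>
     (\<forall>s\<in>S. \<forall>t\<in>S. (s, t) \<in> (Restr R S)\<^sup>*) \<and>
     (\<forall>x\<in>{a, b, c}. (u, x) \<in> R \<and> (v, x) \<in> R \<and> (\<exists>s\<in>S. (s, x) \<in> R))"

lemma half_open_arc:
  fixes g :: "real \<Rightarrow> 'a::t2_space"
  assumes "Path_Connected.arc g"
  shows "Topological_Spaces.connected (path_image g - {pathfinish g})"
    and "pathfinish g \<in> closure (path_image g - {pathfinish g})"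
proof -
  have cont: "continuous_on {0..1} g" and inj: "inj_on g {0..1}"
    using assms by (auto simp: arc_def path_def)
  have split: "{0..1::real} = insert 1 {0..<1}" by auto
  have eq: "path_image g - {pathfinish g} = g ` {0..<1}"
    using inj unfolding path_image_def pathfinish_def split by auto
  show "Topological_Spaces.connected (path_image g - {pathfinish g})"
    unfolding eq by (rule connected_continuous_image[OF continuous_on_subset[OF cont]]) auto
  have "g ` closure {0..<1} \<subseteq> closure (g ` {0..<1})"
    by (rule image_closure_subset[OF _ closed_closure closure_subset]) (simp add: cont)
  then show "pathfinish g \<in> closure (path_image g - {pathfinish g})"
    unfolding eq by (auto simp: pathfinish_def)
qed

locale plane_graph = pair_graph G for G :: "'a pair_pre_digraph" +
  fixes p :: "'a \<Rightarrow> complex" and c :: "'a set \<Rightarrow> real \<Rightarrow> complex"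
  assumes drawing: "plane_drawing G p c"
begin

abbreviation img :: "'a \<Rightarrow> 'a \<Rightarrow> complex set" where
  "img x y \<equiv> path_image (c {x, y})"

lemma inj_p: "inj_on p (pverts G)"
  using drawing unfolding plane_drawing_def by auto

lemma edge_in_edges: "(x, y) \<in> parcs G \<Longrightarrow> {x, y} \<in> edges G"
  unfolding edges_def by auto

lemma arc_verts: "(x, y) \<in> parcs G \<Longrightarrow> x \<in> pverts G \<and> y \<in> pverts G \<and> x \<noteq> y"
  using in_arcsD1 in_arcsD2 no_loops' by blast

lemma img_verts:
  assumes "(x, y) \<in> parcs G"
  shows "img x y \<inter> p ` pverts G = {p x, p y}"
  using edge_in_edges[OF assms] drawing unfolding plane_drawing_def by auto

lemma ends_in_img: "(x, y) \<in> parcs G \<Longrightarrow> p x \<in> img x y \<and> p y \<in> img x y"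
  using img_verts by blast

lemma vertex_in_img:
  assumes "(x, y) \<in> parcs G" "t \<in> pverts G" "p t \<in> img x y"
  shows "t \<in> {x, y}"
proof -
  have "p t \<in> {p x, p y}" using img_verts[OF assms(1)] assms by blast
  then show ?thesis using inj_p arc_verts[OF assms(1)] assms(2) by (auto dest: inj_onD)
qed

lemma img_meet:
  assumes "(x, y) \<in> parcs G" "(z, w) \<in> parcs G" "{x, y} \<noteq> {z, w}" "q \<in> img x y" "q \<in> img z w"
  shows "\<exists>t. t \<in> {x, y} \<and> t \<in> {z, w} \<and> q = p t"
proof -
  have "\<forall>e\<in>edges G. \<forall>f\<in>edges G. e \<noteq> f \<longrightarrow> path_image (c e) \<inter> path_image (c f) \<subseteq> p ` pverts G"
    using drawing unfolding plane_drawing_def by (elim conjE)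
  then have "img x y \<inter> img z w \<subseteq> p ` pverts G"
    using edge_in_edges[OF assms(1)] edge_in_edges[OF assms(2)] assms(3) by metis
  then obtain t where t: "t \<in> pverts G" "q = p t" using assms(4,5) by blast
  then show ?thesis using vertex_in_img[OF assms(1) t(1)] vertex_in_img[OF assms(2) t(1)] assms(4,5) by blast
qed

lemma oriented_arc:
  assumes "(x, y) \<in> parcs G"
  shows "\<exists>g. Path_Connected.arc g \<and> pathstart g = p x \<and> pathfinish g = p y \<and> path_image g = img x y"
proof -
  have a: "Path_Connected.arc (c {x, y})" and e: "{pathstart (c {x, y}), pathfinish (c {x, y})} = {p x, p y}"
    using edge_in_edges[OF assms] drawing unfolding plane_drawing_def by auto
  consider "pathstart (c {x, y}) = p x" "pathfinish (c {x, y}) = p y"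
    | "pathstart (c {x, y}) = p y" "pathfinish (c {x, y}) = p x"
    using e by (auto simp: doubleton_eq_iff)
  then show ?thesis
  proof cases
    case 1 then show ?thesis using a by blast
  next
    case 2 then show ?thesis using a
      by (intro exI[of _ "reversepath (c {x, y})"]) (auto simp: arc_reversepath)
  qed
qed

lemma two_edge_arc:
  assumes "(u, x) \<in> parcs G" "(v, x) \<in> parcs G" "u \<noteq> v"
  shows "\<exists>g. Path_Connected.arc g \<and> pathstart g = p u \<and> pathfinish g = p v \<and> path_image g = img u x \<union> img v x"
proof -
  have "(x, v) \<in> parcs G" using assms arcs_symmetric by blast
  then obtain g h where g: "Path_Connected.arc g" "pathstart g = p u" "pathfinish g = p x" "path_image g = img u x"
    and h: "Path_Connected.arc h" "pathstart h = p x" "pathfinish h = p v" "path_image h = img x v"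
    using oriented_arc assms by metis
  have "path_image g \<inter> path_image h \<subseteq> {p x}"
    using img_meet[OF assms(1) \<open>(x, v) \<in> parcs G\<close>] assms arc_verts unfolding g h
    by (auto simp: doubleton_eq_iff)
  then have "Path_Connected.arc (g +++ h)" using g h by (intro arc_join) auto
  then show ?thesis using g h
    by (intro exI[of _ "g +++ h"]) (auto simp: path_image_join insert_commute)
qed

lemma two_edge_arcs_meet:
  assumes "(u, x) \<in> parcs G" "(v, x) \<in> parcs G" "(u, y) \<in> parcs G" "(v, y) \<in> parcs G" "distinct [u, v, x, y]"
  shows "(img u x \<union> img v x) \<inter> (img u y \<union> img v y) = {p u, p v}"
proof
  show "{p u, p v} \<subseteq> (img u x \<union> img v x) \<inter> (img u y \<union> img v y)"
    using ends_in_img assms by auto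
  show "(img u x \<union> img v x) \<inter> (img u y \<union> img v y) \<subseteq> {p u, p v}"
  proof
    fix q assume q: "q \<in> (img u x \<union> img v x) \<inter> (img u y \<union> img v y)"
    then obtain r s where rs: "r \<in> {u, v}" "s \<in> {u, v}" "q \<in> img r x" "q \<in> img s y" by auto
    have "(r, x) \<in> parcs G" "(s, y) \<in> parcs G" "{r, x} \<noteq> {s, y}"
      using rs assms by (auto simp: doubleton_eq_iff)
    then obtain t where "t \<in> {r, x}" "t \<in> {s, y}" "q = p t" using img_meet rs by metis
    then show "q \<in> {p u, p v}" using rs assms by auto
  qed
qed

lemma no_K33_pattern: "\<not> K33_pattern (parcs G) u v x y z S"
proof
  assume K: "K33_pattern (parcs G) u v x y z S"
  note K = K[unfolded K33_pattern_def]
  define T where "T = {x, y, z}"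
  have adj: "(u, t) \<in> parcs G" "(v, t) \<in> parcs G" if "t \<in> T" for t
    using K that unfolding T_def by auto
  have "\<forall>t\<in>T. \<exists>s\<in>S. (s, t) \<in> parcs G" using K unfolding T_def by auto
  then obtain n where n: "\<And>t. t \<in> T \<Longrightarrow> n t \<in> S \<and> (n t, t) \<in> parcs G" by metis
  have conS: "(s, t) \<in> (Restr (parcs G) S)\<^sup>*" if "s \<in> S" "t \<in> S" for s t using K that by blast
  have disjS: "S \<inter> ({u, v} \<union> T) = {}" using K unfolding T_def by auto
  have dist: "u \<noteq> v" "u \<notin> T" "v \<notin> T" using K unfolding T_def by auto
  have xT: "x \<in> T" unfolding T_def by simp
  have SV: "S \<subseteq> pverts G"
  proof
    fix s assume s: "s \<in> S"
    have "(s, n x) \<in> (Restr (parcs G) S)\<^sup>*" using conS s n[OF xT] by blast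
    then show "s \<in> pverts G"
      by (cases rule: converse_rtranclE) (use n[OF xT] arc_verts in auto)
  qed
  define L where "L t = img (n t) t - {p t}" for t
  define W where "W = p ` S \<union> (\<Union>(s, t)\<in>Restr (parcs G) S. img s t) \<union> (\<Union>t\<in>T. L t)"
  have conL: "Topological_Spaces.connected (L t)" "p t \<in> closure (L t)" if t: "t \<in> T" for t
  proof -
    obtain g where "Path_Connected.arc g" "pathfinish g = p t" "path_image g = img (n t) t"
      using oriented_arc n[OF t] by blast
    then show "Topological_Spaces.connected (L t)" "p t \<in> closure (L t)" unfolding L_def using half_open_arc by metis+
  qed
  have reach: "connected_component W (p (n x)) (p s)" if "s \<in> S" for s
  proof -
    have "(n x, s) \<in> (Restr (parcs G) S)\<^sup>*" using conS that n[OF xT] by blast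
    then show ?thesis
    proof induction
      case base
      have "p (n x) \<in> W" using n[OF xT] unfolding W_def by auto
      then show ?case by (simp add: connected_component_refl)
    next
      case (step s t)
      obtain g where "Path_Connected.arc g" "path_image g = img s t" using oriented_arc step by blast
      then have "Topological_Spaces.connected (img s t)" using connected_arc_image by metis
      moreover have "img s t \<subseteq> W" using step(2) unfolding W_def by auto
      ultimately have "connected_component W (p s) (p t)"
        using ends_in_img step(2) unfolding connected_component_def by blast
      then show ?case using step.IH connected_component_trans by metis
    qed
  qed
  have "connected_component W (p (n x)) q" if "q \<in> W" for q
  proof -
    consider s where "s \<in> S" "q = p s" | s t where "(s, t) \<in> Restr (parcs G) S" "q \<in> img s t"
      | t where "t \<in> T" "q \<in> L t" using \<open>q \<in> W\<close> unfolding W_def by auto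
    then obtain s A where "s \<in> S" "Topological_Spaces.connected A" "A \<subseteq> W" "p s \<in> A" "q \<in> A"
    proof cases
      case 1 then show ?thesis using that[of s "{q}"] \<open>q \<in> W\<close> by auto
    next
      case 2
      obtain g where "Path_Connected.arc g" "path_image g = img s t" using oriented_arc 2 by blast
      then have "Topological_Spaces.connected (img s t)" using connected_arc_image by metis
      moreover have "img s t \<subseteq> W" using 2 unfolding W_def by auto
      ultimately show ?thesis using that[of s "img s t"] ends_in_img 2 by auto
    next
      case 3
      have "n t \<in> S" "(n t, t) \<in> parcs G" using n 3 by auto
      then have "p (n t) \<noteq> p t" using arc_verts inj_p by (metis inj_onD)
      then have "p (n t) \<in> L t" using ends_in_img \<open>(n t, t) \<in> parcs G\<close> unfolding L_def by auto
      moreover have "L t \<subseteq> W" using 3 unfolding W_def by auto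
      ultimately show ?thesis using that[of "n t" "L t"] \<open>n t \<in> S\<close> conL(1) 3 by auto
    qed
    then have "connected_component W (p s) q" unfolding connected_component_def by blast
    then show ?thesis using reach[OF \<open>s \<in> S\<close>] connected_component_trans by metis
  qed
  then have W_con: "Topological_Spaces.connected W"
    by (metis connected_component_sym connected_component_trans connected_iff_connected_component)
  have W_edge: "W \<inter> img r t = {}" if r: "r \<in> {u, v}" and t: "t \<in> T" for r t
  proof -
    have rt: "(r, t) \<in> parcs G" using adj r t by auto
    have rS: "r \<notin> S" "t \<notin> S" using disjS r t by auto
    have off_verts: "p s \<notin> img r t" if "s \<in> S" for s using vertex_in_img[OF rt, of s] SV rS that by auto
    have off_edges: "img s s' \<inter> img r t = {}" if "(s, s') \<in> Restr (parcs G) S" for s s'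
    proof -
      have ss: "(s, s') \<in> parcs G" "s \<notin> {r, t}" "s' \<notin> {r, t}" using that rS by auto
      have "{s, s'} \<noteq> {r, t}" using ss(2) by auto
      have "q \<notin> img r t" if "q \<in> img s s'" for q
        using img_meet[OF ss(1) rt \<open>{s, s'} \<noteq> {r, t}\<close> that] ss(2,3) by blast
      then show ?thesis by blast
    qed
    have off_ends: "L t' \<inter> img r t = {}" if "t' \<in> T" for t'
    proof -
      have "n t' \<in> S" "(n t', t') \<in> parcs G" using n that by auto
      moreover have "n t' \<noteq> r" "n t' \<noteq> t" "t' \<noteq> r" using \<open>n t' \<in> S\<close> rS r dist that by auto
      ultimately have "q = p t'" if "q \<in> img (n t') t'" "q \<in> img r t" for q
        using img_meet[of "n t'" t' r t q] rt that by auto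
      then show ?thesis unfolding L_def by auto
    qed
    have "q \<notin> img r t" if "q \<in> W" for q
    proof -
      consider s where "s \<in> S" "q = p s" | s s' where "(s, s') \<in> Restr (parcs G) S" "q \<in> img s s'"
        | t' where "t' \<in> T" "q \<in> L t'" using \<open>q \<in> W\<close> unfolding W_def by auto
      then show ?thesis
      proof cases
        case 1 then show ?thesis using off_verts by blast
      next
        case 2 then show ?thesis using off_edges by blast
      next
        case 3 then show ?thesis using off_ends by blast
      qed
    qed
    then show ?thesis by blast
  qed
  have touch: "closure W \<inter> ((img u t \<union> img v t) - {p u, p v}) \<noteq> {}" if "t \<in> T" for t
  proof -
    have "L t \<subseteq> W" using that unfolding W_def by auto
    then have "p t \<in> closure W" using conL(2)[OF that] closure_mono by blast
    moreover have "p t \<in> img u t" using ends_in_img adj that by blast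
    moreover have "p t \<noteq> p u" "p t \<noteq> p v" using adj[OF that] arc_verts inj_p by (metis inj_onD)+
    ultimately show ?thesis by blast
  qed
  have arc: "\<exists>g. Path_Connected.arc g \<and> pathstart g = p u \<and> pathfinish g = p v \<and> path_image g = img u t \<union> img v t"
    if "t \<in> T" for t using two_edge_arc adj that dist by blast
  obtain g1 where g1: "Path_Connected.arc g1" "pathstart g1 = p u" "pathfinish g1 = p v" "path_image g1 = img u x \<union> img v x"
    using arc xT by blast
  obtain g2 where g2: "Path_Connected.arc g2" "pathstart g2 = p u" "pathfinish g2 = p v" "path_image g2 = img u y \<union> img v y"
    using arc[of y] unfolding T_def by blast
  obtain g3 where g3: "Path_Connected.arc g3" "pathstart g3 = p u" "pathfinish g3 = p v" "path_image g3 = img u z \<union> img v z"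
    using arc[of z] unfolding T_def by blast
  have meet: "(img u t \<union> img v t) \<inter> (img u t' \<union> img v t') = {p u, p v}" if "t \<in> T" "t' \<in> T" "t \<noteq> t'" for t t'
    using two_edge_arcs_meet[of u t v t'] adj that dist by auto
  have "y \<in> T" "z \<in> T" "x \<noteq> y" "x \<noteq> z" "y \<noteq> z" using K unfolding T_def by auto
  show False
  proof (rule theta_not_touched_thrice[OF g1(1) g2(1) g3(1) g1(2) g2(2) g3(2) g1(3) g2(3) g3(3) _ _ _ W_con])
    show "path_image g1 \<inter> path_image g2 = {p u, p v}" "path_image g1 \<inter> path_image g3 = {p u, p v}"
      "path_image g2 \<inter> path_image g3 = {p u, p v}"
      unfolding g1(4) g2(4) g3(4) by (rule meet; fact)+
    show "W \<inter> (path_image g1 \<union> path_image g2 \<union> path_image g3) = {}"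
      unfolding g1(4) g2(4) g3(4) Int_Un_distrib
      using W_edge xT \<open>y \<in> T\<close> \<open>z \<in> T\<close> by simp
    show "closure W \<inter> (path_image g1 - {p u, p v}) \<noteq> {}" unfolding g1(4) using touch[OF xT] .
    show "closure W \<inter> (path_image g2 - {p u, p v}) \<noteq> {}" unfolding g2(4) using touch[OF \<open>y \<in> T\<close>] .
    show "closure W \<inter> (path_image g3 - {p u, p v}) \<noteq> {}" unfolding g3(4) using touch[OF \<open>z \<in> T\<close>] .
  qed
qed

end

lemma planar_no_K33_pattern:
  assumes "pair_graph G" "planar G"
  shows "\<not> K33_pattern (parcs G) u v a b c S"
proof -
  obtain p c where "plane_drawing G p c" using assms unfolding planar_def by auto
  then interpret plane_graph G p c using assms by (intro plane_graph.intro plane_graph_axioms.intro)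
  show ?thesis by (rule no_K33_pattern)
qed

subsection \<open>Two graphs with the same connected triples\<close>

definition majority :: "('a \<times> 'a) set \<Rightarrow> 'a \<Rightarrow> 'a \<Rightarrow> 'a \<Rightarrow> bool" where
  "majority R a b c \<longleftrightarrow>
     (a, b) \<in> R \<and> (a, c) \<in> R \<or> (a, b) \<in> R \<and> (b, c) \<in> R \<or> (a, c) \<in> R \<and> (b, c) \<in> R"

locale regular_K33_free =
  fixes V :: "'a set" and R :: "('a \<times> 'a) set" and d :: nat
  assumes finite_V: "finite V" and card_V: "7 \<le> card V"
    and wf: "(x, y) \<in> R \<Longrightarrow> x \<in> V \<and> y \<in> V" and irrefl: "(x, x) \<notin> R"
    and sym_R: "sym R"
    and no_closed_set: "\<lbrakk>S \<subseteq> V; S \<noteq> {}; R `` S \<subseteq> S\<rbrakk> \<Longrightarrow> S = V"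
    and degree: "v \<in> V \<Longrightarrow> card (R `` {v}) = d"
    and K33_free: "\<not> K33_pattern R u v a b c S"
begin

lemma symR: "(x, y) \<in> R \<Longrightarrow> (y, x) \<in> R"
  using sym_R by (rule symD)

lemma finite_nbrs: "finite (R `` A)"
  using finite_V by (rule rev_finite_subset) (use wf in auto)

lemma no_K33:
  assumes "distinct [u, v, w, a, b, c]"
    and "\<forall>x\<in>{u, v, w}. \<forall>y\<in>{a, b, c}. (x, y) \<in> R"
  shows False
proof -
  have "K33_pattern R u v a b c {w}" unfolding K33_pattern_def using assms by auto
  then show False using K33_free by blast
qed

lemma few_common_nbrs:
  assumes "distinct [a, b, c]"
    and Z: "\<And>z. z \<in> Z \<Longrightarrow> (z, a) \<in> R \<and> (z, b) \<in> R \<and> (z, c) \<in> R"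
  shows "card Z \<le> 2"
proof (rule ccontr)
  assume "\<not> card Z \<le> 2"
  then have "3 \<le> card Z" by simp
  then obtain T where T: "T \<subseteq> Z" "card T = 3"
    by (meson obtain_subset_with_card_n)
  then obtain u v w where "T = {u, v, w}" "distinct [u, v, w]" by (auto simp: card_3_iff)
  then have uvw: "u \<in> Z" "v \<in> Z" "w \<in> Z" "distinct [u, v, w]" using T by auto
  have "\<And>z. z \<in> Z \<Longrightarrow> z \<notin> {a, b, c}" using Z irrefl by blast
  then have "distinct [u, v, w, a, b, c]" using uvw assms(1) by auto
  then show False by (rule no_K33) (use Z uvw in auto)
qed

lemma exits:
  assumes "S \<subseteq> V" "S \<noteq> {}" "card S < 7"
  obtains x z where "x \<in> S" "z \<in> V" "z \<notin> S" "(x, z) \<in> R"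
proof -
  have "\<not> R `` S \<subseteq> S" using no_closed_set[OF assms(1,2)] assms(3) card_V by auto
  then show thesis using that wf by blast
qed

end

locale same_triples = R: regular_K33_free V R d + Q: regular_K33_free V Q e for V :: "'a set" and R d Q e +
  assumes same_majority: "distinct [a, b, c] \<Longrightarrow> {a, b, c} \<subseteq> V \<Longrightarrow> majority R a b c = majority Q a b c"
begin

lemma swapped: "same_triples V Q e R d"
  by unfold_locales (simp add: same_majority)

lemma red_unique:
  assumes "(u, v) \<in> R - Q" "(u, w) \<in> R - Q"
  shows "v = w"
  using same_majority[of u v w] assms R.wf R.irrefl unfolding majority_def by auto

lemma blue_unique: "(u, v) \<in> Q - R \<Longrightarrow> (u, w) \<in> Q - R \<Longrightarrow> v = w"
  using same_triples.red_unique[OF swapped] .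

lemma twins:
  assumes "(u, v) \<in> R - Q \<or> (u, v) \<in> Q - R" "w \<in> V" "w \<noteq> u" "w \<noteq> v"
    and "(w, u) \<in> R \<longleftrightarrow> (w, u) \<in> Q" "(w, v) \<in> R \<longleftrightarrow> (w, v) \<in> Q"
  shows "(w, u) \<in> R \<longleftrightarrow> (w, v) \<in> R"
proof -
  have "u \<noteq> v" "u \<in> V" "v \<in> V" using assms(1) R.wf Q.wf R.irrefl Q.irrefl by blast+
  then have "majority R w u v = majority Q w u v" using same_majority[of w u v] assms by auto
  then show ?thesis unfolding majority_def using assms by blast
qed

lemma same_unless_partner:
  assumes "(u, a) \<in> R - Q" "(u, b) \<in> Q - R" "w \<noteq> a" "w \<noteq> b"
  shows "(w, u) \<in> R \<longleftrightarrow> (w, u) \<in> Q"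
  using red_unique[OF assms(1), of w] blue_unique[OF assms(2), of w] assms(3,4) R.symR Q.symR by blast

lemma degree_balance:
  assumes "v \<in> V"
  shows "d + card ((Q - R) `` {v}) = e + card ((R - Q) `` {v})"
proof -
  have "R `` {v} = (R \<inter> Q) `` {v} \<union> (R - Q) `` {v}" "Q `` {v} = (R \<inter> Q) `` {v} \<union> (Q - R) `` {v}"
    by auto
  moreover have "(R \<inter> Q) `` {v} \<inter> (R - Q) `` {v} = {}" "(R \<inter> Q) `` {v} \<inter> (Q - R) `` {v} = {}"
    by auto
  moreover have "finite ((R \<inter> Q) `` {v})" "finite ((R - Q) `` {v})" "finite ((Q - R) `` {v})"
    using R.finite_nbrs[of "{v}"] Q.finite_nbrs[of "{v}"] by (auto elim: rev_finite_subset)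
  ultimately have "card (R `` {v}) = card ((R \<inter> Q) `` {v}) + card ((R - Q) `` {v})"
    "card (Q `` {v}) = card ((R \<inter> Q) `` {v}) + card ((Q - R) `` {v})"
    by (metis card_Un_disjoint)+
  then show ?thesis using R.degree[OF assms] Q.degree[OF assms] by linarith
qed

lemma no_alternating_4_cycle:
  assumes r01: "(x0, x1) \<in> R - Q" and b12: "(x1, x2) \<in> Q - R"
    and r23: "(x2, x3) \<in> R - Q" and b30: "(x3, x0) \<in> Q - R"
  shows False
proof -
  define X where "X = {x0, x1, x2, x3}"
  have sym: "(x1, x0) \<in> R - Q" "(x2, x1) \<in> Q - R" "(x3, x2) \<in> R - Q" "(x0, x3) \<in> Q - R"
    using assms R.symR Q.symR by blast+
  have dist: "distinct [x0, x1, x2, x3]"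
    using assms sym R.irrefl Q.irrefl red_unique by auto
  have XV: "X \<subseteq> V" unfolding X_def using assms R.wf by blast
  have cardX: "card X = 4" unfolding X_def using dist by simp
  define Z where "Z = {z. z \<notin> X \<and> (z, x0) \<in> R}"
  have uniform: "(z, x) \<in> R \<longleftrightarrow> (z, x0) \<in> R" if z: "z \<in> V" "z \<notin> X" and x: "x \<in> X" for z x
  proof -
    have zx: "z \<noteq> x0" "z \<noteq> x1" "z \<noteq> x2" "z \<noteq> x3" using z unfolding X_def by auto
    note s = same_unless_partner[OF r01 sym(4) zx(2,4)] same_unless_partner[OF sym(1) b12 zx(1,3)]
      same_unless_partner[OF r23 sym(2) zx(4,2)] same_unless_partner[OF sym(3) b30 zx(3,1)]
    have "(z, x0) \<in> R \<longleftrightarrow> (z, x1) \<in> R" using twins[of x0 x1 z] r01 z zx s by blast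
    moreover have "(z, x1) \<in> R \<longleftrightarrow> (z, x2) \<in> R" using twins[of x1 x2 z] b12 z zx s by blast
    moreover have "(z, x2) \<in> R \<longleftrightarrow> (z, x3) \<in> R" using twins[of x2 x3 z] r23 z zx s by blast
    ultimately show ?thesis using x unfolding X_def by blast
  qed
  have ZV: "Z \<subseteq> V" unfolding Z_def using R.wf by blast
  have adj: "(z, x) \<in> R" if "z \<in> Z" "x \<in> X" for z x
    using uniform[of z x] that ZV unfolding Z_def by auto
  have in_Z: "z \<in> Z" if "(x, z) \<in> R" "x \<in> X" "z \<notin> X" for x z
    using uniform[of z x] that R.symR R.wf unfolding Z_def by blast
  have finZ: "finite Z" using ZV R.finite_V by (rule finite_subset)
  have cardZ: "card Z \<le> 2"
    by (rule R.few_common_nbrs[of x0 x1 x2]) (use dist adj in \<open>auto simp: X_def\<close>)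
  obtain z where z: "z \<in> Z"
    by (rule R.exits[OF XV]) (use cardX in_Z in \<open>auto simp: X_def\<close>)
  have nbrs_Z: "X \<subseteq> R `` {z}" if "z \<in> Z" for z using adj that by blast
  have "card X \<le> d" using card_mono[OF R.finite_nbrs nbrs_Z[OF z]] R.degree z ZV by auto
  moreover have "R `` {x0} \<subseteq> {x1, x2} \<union> Z"
    using in_Z[of x0] b30 sym R.irrefl unfolding X_def by auto
  then have "card (R `` {x0}) \<le> card ({x1, x2} \<union> Z)" using finZ by (intro card_mono) auto
  then have "d \<le> 2 + card Z" using card_Un_le[of "{x1, x2}" Z] R.degree[of x0] XV dist
    unfolding X_def by auto
  ultimately have d: "d = 4" using cardX cardZ by linarith
  have "R `` {z} = X" if "z \<in> Z" for z
    using card_subset_eq[OF R.finite_nbrs nbrs_Z[OF that]] R.degree[of z] that ZV cardX d by auto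
  then have "R `` (X \<union> Z) \<subseteq> X \<union> Z" using in_Z by blast
  then have "X \<union> Z = V" using R.no_closed_set[of "X \<union> Z"] XV ZV z by blast
  then have "7 \<le> card (X \<union> Z)" using R.card_V by simp
  then show False using card_Un_le[of X Z] cardX cardZ by linarith
qed

lemma no_alternating_path:
  assumes r01: "(x0, x1) \<in> R - Q" and b12: "(x1, x2) \<in> Q - R" and r23: "(x2, x3) \<in> R - Q"
    and b34: "(x3, x4) \<in> Q - R" and r45: "(x4, x5) \<in> R - Q" and "x4 \<noteq> x0"
    and b0: "(x0, y0) \<in> Q - R" and b5: "(x5, y5) \<in> Q - R"
  shows False
proof -
  have sym: "(x1, x0) \<in> R - Q" "(x2, x1) \<in> Q - R" "(x3, x2) \<in> R - Q" "(x4, x3) \<in> Q - R"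
    "(x5, x4) \<in> R - Q"
    using assms R.symR Q.symR by blast+
  have dist: "distinct [x0, x1, x2, x3, x4, x5]"
  proof -
    have "x0 \<noteq> x1" "x1 \<noteq> x2" "x2 \<noteq> x3" "x3 \<noteq> x4" "x4 \<noteq> x5"
      using assms R.irrefl Q.irrefl by blast+
    moreover from this have "x0 \<noteq> x2" "x1 \<noteq> x3" "x2 \<noteq> x4" "x3 \<noteq> x5" using assms sym by blast+
    moreover from calculation have "x0 \<noteq> x3" "x1 \<noteq> x4" "x2 \<noteq> x5"
      using red_unique blue_unique assms sym by metis+
    moreover from calculation have "x1 \<noteq> x5" "x0 \<noteq> x5"
      using red_unique assms sym by metis+
    ultimately show ?thesis using \<open>x4 \<noteq> x0\<close> by auto
  qed
  have ne: "x0 \<noteq> x1" "x0 \<noteq> x2" "x0 \<noteq> x3" "x0 \<noteq> x4" "x0 \<noteq> x5" "x1 \<noteq> x2" "x1 \<noteq> x3" "x1 \<noteq> x4"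
    "x1 \<noteq> x5" "x2 \<noteq> x3" "x2 \<noteq> x4" "x2 \<noteq> x5" "x3 \<noteq> x4" "x3 \<noteq> x5" "x4 \<noteq> x5"
    using dist by auto
  note ne = ne ne[symmetric]
  have V: "x0 \<in> V" "x1 \<in> V" "x2 \<in> V" "x3 \<in> V" "x4 \<in> V" "x5 \<in> V"
    using assms R.wf by blast+
  have same1: "(w, x1) \<in> R \<longleftrightarrow> (w, x1) \<in> Q" if "w \<noteq> x0" "w \<noteq> x2" for w
    using same_unless_partner[OF sym(1) b12] that by blast
  have same2: "(w, x2) \<in> R \<longleftrightarrow> (w, x2) \<in> Q" if "w \<noteq> x1" "w \<noteq> x3" for w
    using same_unless_partner[OF r23 sym(2)] that by blast
  have same3: "(w, x3) \<in> R \<longleftrightarrow> (w, x3) \<in> Q" if "w \<noteq> x2" "w \<noteq> x4" for w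
    using same_unless_partner[OF sym(3) b34] that by blast
  have same4: "(w, x4) \<in> R \<longleftrightarrow> (w, x4) \<in> Q" if "w \<noteq> x3" "w \<noteq> x5" for w
    using same_unless_partner[OF r45 sym(4)] that by blast
  have swap: "(x, y) \<in> R \<longleftrightarrow> (y, x) \<in> R" "(x, y) \<in> Q \<longleftrightarrow> (y, x) \<in> Q" for x y
    using R.symR Q.symR by blast+
  have same15: "(x1, x5) \<in> R \<longleftrightarrow> (x1, x5) \<in> Q" using same1[of x5] ne swap[of x1 x5] by blast
  have same25: "(x2, x5) \<in> R \<longleftrightarrow> (x2, x5) \<in> Q" using same2[of x5] ne swap[of x2 x5] by blast
  have e13: "(x1, x3) \<in> R \<longleftrightarrow> (x1, x4) \<in> R"
    using twins[of x3 x4 x1] b34 V ne same3[of x1] same4[of x1] by blast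
  have e15: "(x1, x5) \<in> R \<longleftrightarrow> (x1, x4) \<in> R"
    using twins[of x4 x5 x1] r45 V ne same15 same4[of x1] by blast
  have e25: "(x2, x5) \<in> R \<longleftrightarrow> (x1, x4) \<in> R"
    using twins[of x1 x2 x5] b12 V ne same1[of x5] same2[of x5] e15 swap[of x5] by blast
  have e24: "(x2, x4) \<in> R \<longleftrightarrow> (x1, x4) \<in> R"
    using twins[of x4 x5 x2] r45 V ne same25 same4[of x2] e25 by blast
  show False
  proof (cases "(x1, x4) \<in> R")
    case True
    have K: False if z: "(z, x3) \<in> R" "(z, x4) \<in> R" "(z, x5) \<in> R" "z \<noteq> x1" "z \<noteq> x2" for z
    proof (rule R.no_K33[of x1 x2 z x3 x4 x5])
      have "z \<noteq> x3" "z \<noteq> x4" "z \<noteq> x5" using z R.irrefl by blast+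
      then show "distinct [x1, x2, z, x3, x4, x5]" using z dist by auto
    qed (use True z e13 e15 e25 e24 r23 in auto)
    show False
    proof (cases "y5 = x0")
      case True
      define X where "X = {x0, x1, x2, x3, x4, x5}"
      have "card X \<le> 6" unfolding X_def using dist by simp
      then obtain x z where xz: "x \<in> X" "z \<in> V" "z \<notin> X" "(x, z) \<in> R"
        using R.exits[of X] V unfolding X_def by auto
      have nz: "z \<noteq> x0" "z \<noteq> x1" "z \<noteq> x2" "z \<noteq> x3" "z \<noteq> x4" "z \<noteq> x5"
        using xz unfolding X_def by auto
      have b50: "(x5, x0) \<in> Q - R" "(x0, x5) \<in> Q - R" using b5 True R.symR Q.symR by blast+
      have same5: "(z, x5) \<in> R \<longleftrightarrow> (z, x5) \<in> Q" using same_unless_partner[OF sym(5) b50(1)] nz by blast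
      have same0: "(z, x0) \<in> R \<longleftrightarrow> (z, x0) \<in> Q" using same_unless_partner[OF r01 b50(2)] nz by blast
      note s = same0 same1[OF nz(1,3)] same2[OF nz(2,4)] same3[OF nz(3,5)] same4[OF nz(4,6)] same5
      have "(z, x0) \<in> R \<longleftrightarrow> (z, x1) \<in> R" using twins[of x0 x1 z] r01 xz(2) nz s by blast
      moreover have "(z, x1) \<in> R \<longleftrightarrow> (z, x2) \<in> R" using twins[of x1 x2 z] b12 xz(2) nz s by blast
      moreover have "(z, x2) \<in> R \<longleftrightarrow> (z, x3) \<in> R" using twins[of x2 x3 z] r23 xz(2) nz s by blast
      moreover have "(z, x3) \<in> R \<longleftrightarrow> (z, x4) \<in> R" using twins[of x3 x4 z] b34 xz(2) nz s by blast
      moreover have "(z, x4) \<in> R \<longleftrightarrow> (z, x5) \<in> R" using twins[of x4 x5 z] r45 xz(2) nz s by blast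
      moreover have "(z, x) \<in> R" using R.symR xz by blast
      ultimately show False using K[of z] xz(1) nz unfolding X_def by blast
    next
      case False
      have same05: "(x0, x5) \<in> R \<longleftrightarrow> (x0, x5) \<in> Q"
        using same_unless_partner[OF sym(5) b5, of x0] False ne by blast
      have e04: "(x0, x4) \<in> R"
        using twins[of x0 x1 x4] r01 V ne same1[of x4] same4[of x0] \<open>(x1, x4) \<in> R\<close>
          swap[of x4 x0] swap[of x4 x1] by blast
      have e03: "(x0, x3) \<in> R" using twins[of x3 x4 x0] b34 V ne same3[of x0] same4[of x0] e04 by blast
      have e05: "(x0, x5) \<in> R" using twins[of x4 x5 x0] r45 V ne same05 same4[of x0] e04 by blast
      show False using K[of x0] e03 e04 e05 ne by blast
    qed
  next
    case False
    define Z where "Z = R `` {x1} - {x0}"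
    have Z: "(z, x1) \<in> R \<and> (z, x2) \<in> R \<and> (z, x3) \<in> R \<and> (z, x4) \<in> R" if "z \<in> Z" for z
    proof -
      have z: "(x1, z) \<in> R" "z \<in> V" using that R.wf unfolding Z_def by auto
      have nz: "z \<noteq> x0" "z \<noteq> x1" "z \<noteq> x2" "z \<noteq> x3" "z \<noteq> x4" "z \<noteq> x5"
        using that False e13 e15 b12 R.irrefl unfolding Z_def by auto
      note s = same1[OF nz(1,3)] same2[OF nz(2,4)] same3[OF nz(3,5)] same4[OF nz(4,6)]
      have "(z, x1) \<in> R \<longleftrightarrow> (z, x2) \<in> R" using twins[of x1 x2 z] b12 z(2) nz s by blast
      moreover have "(z, x2) \<in> R \<longleftrightarrow> (z, x3) \<in> R" using twins[of x2 x3 z] r23 z(2) nz s by blast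
      moreover have "(z, x3) \<in> R \<longleftrightarrow> (z, x4) \<in> R" using twins[of x3 x4 z] b34 z(2) nz s by blast
      ultimately show ?thesis using z R.symR by blast
    qed
    have "card Z \<le> 2" by (rule R.few_common_nbrs[of x1 x2 x3]) (use Z dist in auto)
    moreover have cZ: "card Z = d - 1"
      unfolding Z_def using R.degree[of x1] V sym(1) by (simp add: R.finite_nbrs)
    ultimately have "d \<le> 3" by linarith
    have "Z \<noteq> {}"
    proof
      assume "Z = {}"
      then have "d \<le> 1" using cZ by simp
      have "card (R `` {x0}) \<le> Suc 0" using R.degree V \<open>d \<le> 1\<close> by simp
      then have "R `` {x0} \<subseteq> {x1}" using r01 R.finite_nbrs[of "{x0}"] by (auto simp: card_le_Suc0_iff_eq)
      moreover have "R `` {x1} \<subseteq> {x0}" using \<open>Z = {}\<close> unfolding Z_def by auto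
      ultimately have "R `` {x0, x1} \<subseteq> {x0, x1}" by blast
      then have "{x0, x1} = V" using V by (intro R.no_closed_set) simp_all
      then have "7 \<le> card {x0, x1}" using R.card_V by simp
      then show False using dist by simp
    qed
    then obtain z where "z \<in> Z" by blast
    then have "{x1, x2, x3, x4} \<subseteq> R `` {z}" using Z by blast
    then have "card {x1, x2, x3, x4} \<le> card (R `` {z})" using R.finite_nbrs by (rule card_mono[rotated])
    moreover have "z \<in> V" using Z \<open>z \<in> Z\<close> R.wf by blast
    ultimately have "4 \<le> d" using R.degree dist by simp
    then show False using \<open>d \<le> 3\<close> by simp
  qed
qed

lemma equal_degrees:
  assumes "d = e"
  shows "R = Q"
proof (rule ccontr)
  assume "R \<noteq> Q"
  have fin: "finite ((R - Q) `` {v})" "finite ((Q - R) `` {v})" for v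
    using R.finite_nbrs[of "{v}"] Q.finite_nbrs[of "{v}"] by (auto elim: rev_finite_subset)
  have bal: "card ((Q - R) `` {v}) = card ((R - Q) `` {v})" if "v \<in> V" for v
    using degree_balance[OF that] assms by simp
  have blue: "\<exists>w. (v, w) \<in> Q - R" if "(u, v) \<in> R - Q" for u v
  proof -
    have "u \<in> (R - Q) `` {v}" "v \<in> V" using that R.symR Q.symR R.wf by blast+
    then have "(Q - R) `` {v} \<noteq> {}" using bal fin by (metis card_0_eq card.empty empty_iff)
    then show ?thesis by blast
  qed
  have red: "\<exists>w. (v, w) \<in> R - Q" if "(u, v) \<in> Q - R" for u v
  proof -
    have "u \<in> (Q - R) `` {v}" "v \<in> V" using that R.symR Q.symR Q.wf by blast+
    then have "(R - Q) `` {v} \<noteq> {}" using bal fin by (metis card_0_eq card.empty empty_iff)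
    then show ?thesis by blast
  qed
  obtain x0 x1 where r01: "(x0, x1) \<in> R - Q"
  proof -
    from \<open>R \<noteq> Q\<close> obtain a b where "(a, b) \<in> R - Q \<or> (a, b) \<in> Q - R" by auto
    then show thesis using red that by blast
  qed
  obtain x2 where b12: "(x1, x2) \<in> Q - R" using blue r01 by blast
  obtain x3 where r23: "(x2, x3) \<in> R - Q" using red b12 by blast
  obtain x4 where b34: "(x3, x4) \<in> Q - R" using blue r23 by blast
  obtain x5 where r45: "(x4, x5) \<in> R - Q" using red b34 by blast
  obtain y5 where b5: "(x5, y5) \<in> Q - R" using blue r45 by blast
  have "(x1, x0) \<in> R - Q" using r01 R.symR Q.symR by blast
  then obtain y0 where b0: "(x0, y0) \<in> Q - R" using blue by blast
  show False
  proof (cases "x4 = x0")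
    case True
    then show ?thesis using no_alternating_4_cycle[OF r01 b12 r23] b34 by blast
  next
    case False
    then show ?thesis using no_alternating_path[OF r01 b12 r23 b34 r45 _ b0 b5] by blast
  qed
qed

lemma unequal_degrees:
  assumes "e < d"
  shows False
proof -
  have bound: "card ((R - Q) `` {v}) \<le> 1" for v
    using red_unique by (cases "finite ((R - Q) `` {v})") (auto simp: card_le_Suc0_iff_eq)
  have bal: "card ((Q - R) `` {v}) = 0" "card ((R - Q) `` {v}) = 1" if "v \<in> V" for v
    using degree_balance[OF that] bound[of v] assms by linarith+
  have fin: "finite ((Q - R) `` {v})" for v
    using Q.finite_nbrs[of "{v}"] by (auto elim: rev_finite_subset)
  have QR: "Q \<subseteq> R" using bal(1) fin Q.wf by fastforce
  have "\<exists>w. (v, w) \<in> R - Q" if "v \<in> V" for v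
    using bal(2)[OF that] by (metis Image_singleton_iff card.empty ex_in_conv zero_neq_one)
  then obtain m where m: "\<And>v. v \<in> V \<Longrightarrow> (v, m v) \<in> R - Q" by metis
  have m_eq: "w = m v" if "(v, w) \<in> R - Q" for v w
    using red_unique[OF that m] that R.wf by blast
  have sym: "(x, y) \<in> R - Q \<Longrightarrow> (y, x) \<in> R - Q" for x y using R.symR Q.symR by blast
  have mV: "m v \<in> V" "m v \<noteq> v" "m (m v) = v" if "v \<in> V" for v
    using m[OF that] R.wf R.irrefl m_eq[OF sym[OF m[OF that]]] by auto
  have twin: "(w, v) \<in> R \<longleftrightarrow> (w, m v) \<in> R" if "v \<in> V" "w \<in> V" "w \<noteq> v" "w \<noteq> m v" for v w
  proof -
    have "(w, v) \<in> R \<longleftrightarrow> (w, v) \<in> Q" "(w, m v) \<in> R \<longleftrightarrow> (w, m v) \<in> Q"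
      using m_eq[OF sym, of w v] m_eq[OF sym, of w "m v"] mV that QR by auto
    then show ?thesis using twins[of v "m v" w] m that by blast
  qed
  have green: "(x, y) \<in> Q \<longleftrightarrow> (x, y) \<in> R \<and> y \<noteq> m x" if "x \<in> V" for x y
    using m[OF that] m_eq QR by blast
  define comp where "comp h x = {y. (x, y) \<in> (Restr R (V - {h, m h}))\<^sup>*}" for h x
  have comp_sub: "comp h x \<subseteq> V - {h, m h}" if "x \<in> V - {h, m h}" for h x
  proof
    fix y assume "y \<in> comp h x"
    then have "(x, y) \<in> (Restr R (V - {h, m h}))\<^sup>*" unfolding comp_def by simp
    then show "y \<in> V - {h, m h}" by induction (use that in auto)
  qed
  have "V \<noteq> {}" using R.card_V by auto
  then obtain v0 where v0: "v0 \<in> V" by blast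
  then obtain w0 where w0: "(v0, w0) \<in> Q" using Q.exits[of "{v0}"] by auto
  have "card (comp h x) \<le> card V" if hx: "(h, x) \<in> Q" for h x
  proof -
    have "x \<in> V" "x \<noteq> h" "x \<noteq> m h" using hx Q.wf Q.irrefl green by blast+
    then have "comp h x \<subseteq> V" using comp_sub[of x h] by blast
    then show ?thesis using R.finite_V by (rule card_mono[rotated])
  qed
  then have "\<forall>q. q \<in> Q \<longrightarrow> (case q of (h, x) \<Rightarrow> card (comp h x)) < Suc (card V)"
    by (auto simp: less_Suc_eq_le)
  \<comment> \<open>Maximality makes every other neighbour \<open>x2\<close> of \<open>h\<close> lie in the component of \<open>x1\<close>: otherwise
    removing \<open>x2\<close> and its twin would leave a larger component around \<open>h\<close>.\<close>
  from ex_has_greatest_nat[OF w0 this]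
  obtain h x1 where hx: "(h, x1) \<in> Q"
    and maximal: "\<And>h' x'. (h', x') \<in> Q \<Longrightarrow> card (comp h' x') \<le> card (comp h x1)"
    by force
  have V: "h \<in> V" "x1 \<in> V" "m h \<in> V" "m x1 \<in> V" using hx Q.wf mV by blast+
  have ne: "x1 \<noteq> h" "x1 \<noteq> m h" "m x1 \<noteq> h" "m x1 \<noteq> m h" "m x1 \<noteq> x1" "m h \<noteq> h"
  proof -
    show "x1 \<noteq> h" using hx Q.irrefl by blast
    show "x1 \<noteq> m h" using hx green[OF V(1)] by blast
    show "m x1 \<noteq> x1" "m h \<noteq> h" using mV V by blast+
    show "m x1 \<noteq> h" using \<open>x1 \<noteq> m h\<close> mV(3)[OF V(2)] by auto
    show "m x1 \<noteq> m h" using \<open>x1 \<noteq> h\<close> mV(3)[OF V(2)] mV(3)[OF V(1)] by auto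
  qed
  have adj: "(h, x1) \<in> R" "(h, m x1) \<in> R" "(m h, x1) \<in> R" "(m h, m x1) \<in> R"
  proof -
    show hx1: "(h, x1) \<in> R" using hx QR by blast
    show "(h, m x1) \<in> R" using hx1 twin[of x1 h] V ne by blast
    show mhx: "(m h, x1) \<in> R" using hx1 twin[of h x1] V ne R.symR by blast
    show "(m h, m x1) \<in> R" using mhx twin[of x1 "m h"] V ne ne[symmetric] by metis
  qed
  have hm: "(h, m h) \<in> R" "(x1, m x1) \<in> R" using m V by blast+
  obtain x2 where x2: "(h, x2) \<in> R" "x2 \<noteq> m h" "x2 \<noteq> x1" "x2 \<noteq> m x1"
  proof (rule ccontr)
    assume "\<not> thesis"
    then have sub: "R `` {h} \<subseteq> {m h, x1, m x1}" using that by blast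
    define X where "X = {h, m h, x1, m x1}"
    have cardX: "card X = 4" "finite X" unfolding X_def using ne by auto
    have XV: "X \<subseteq> V" unfolding X_def using V by simp
    have "card (R `` {h}) \<le> card {m h, x1, m x1}" using sub by (intro card_mono) auto
    then have "d \<le> 3" using R.degree[of h] V ne by simp
    have nbrs: "R `` {x} \<subseteq> X" if "x \<in> X" for x
    proof -
      have "X - {x} \<subseteq> R `` {x}" using that adj hm R.symR unfolding X_def by blast
      moreover have "card (X - {x}) = 3" using that cardX by simp
      ultimately have "X - {x} = R `` {x}" using \<open>d \<le> 3\<close> R.degree[of x] that XV R.finite_nbrs
        by (intro card_seteq) auto
      then show ?thesis by blast
    qed
    then have "X = V" using R.no_closed_set[OF XV] unfolding X_def by blast
    then show False using cardX R.card_V by simp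
  qed
  have x2V: "x2 \<in> V" "m x2 \<in> V" using x2 R.wf mV by blast+
  have ne2: "x2 \<noteq> h" "m x2 \<noteq> x2" "m x2 \<noteq> h" "m x2 \<noteq> m h" "m x2 \<noteq> x1" "m x2 \<noteq> m x1"
  proof -
    show "x2 \<noteq> h" using x2 R.irrefl by blast
    show "m x2 \<noteq> x2" using mV x2V by blast
    show "m x2 \<noteq> h" "m x2 \<noteq> x1" using x2 mV(3)[OF x2V(1)] by auto
    show "m x2 \<noteq> m h" "m x2 \<noteq> m x1"
      using \<open>x2 \<noteq> h\<close> x2 mV(3)[OF x2V(1)] mV(3)[OF V(1)] mV(3)[OF V(2)] by auto
  qed
  have x2m: "(x2, m x2) \<in> R" using m x2V by blast
  have x2_in: "x2 \<in> comp h x1"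
  proof (rule ccontr)
    assume n: "x2 \<notin> comp h x1"
    have mn: "m x2 \<notin> comp h x1"
    proof
      assume "m x2 \<in> comp h x1"
      moreover have "(m x2, x2) \<in> Restr R (V - {h, m h})" using x2m R.symR x2V ne2 x2 by blast
      ultimately show False using n unfolding comp_def by (auto intro: rtrancl_into_rtrancl)
    qed
    have "h \<in> comp x2 h" unfolding comp_def by simp
    moreover have "comp h x1 \<subseteq> comp x2 h"
    proof
      fix y assume "y \<in> comp h x1"
      then have "(x1, y) \<in> (Restr R (V - {h, m h}))\<^sup>*" unfolding comp_def by simp
      then show "y \<in> comp x2 h"
      proof induction
        case base
        have "(h, x1) \<in> Restr R (V - {x2, m x2})" using adj V ne2 x2 by auto
        then show ?case unfolding comp_def by blast
      next
        case (step y z)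
        then have "y \<in> comp h x1" "z \<in> comp h x1"
          unfolding comp_def by (auto intro: rtrancl_into_rtrancl)
        then have "(y, z) \<in> Restr R (V - {x2, m x2})" using step(2) n mn by auto
        then show ?case using step.IH unfolding comp_def by (auto intro: rtrancl_into_rtrancl)
      qed
    qed
    moreover have "h \<notin> comp h x1" using comp_sub[of x1 h] V ne by auto
    ultimately have "comp h x1 \<subset> comp x2 h" by blast
    moreover have "finite (comp x2 h)"
      using comp_sub[of h x2] V ne2 R.finite_V by (metis Diff_iff finite_subset finite_Diff insertE singletonD)
    ultimately have "card (comp h x1) < card (comp x2 h)" by (rule psubset_card_mono[rotated])
    moreover have "(x2, h) \<in> Q" using green[OF x2V(1)] R.symR x2(1) ne2 by auto
    ultimately show False using maximal[of x2 h] by simp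
  qed
  define U where "U = V - {h, m h, x1, m x1, x2}"
  define S where "S = {y. (m x2, y) \<in> (Restr R U)\<^sup>*}"
  have base: "m x2 \<in> S" unfolding S_def by simp
  have mU: "m x2 \<in> U" unfolding U_def using x2V ne2 by auto
  have S_step: "z \<in> S" if "y \<in> S" "(y, z) \<in> R" "y \<in> U" "z \<in> U" for y z
    using that unfolding S_def by (auto intro: rtrancl_into_rtrancl)
  have SU: "S \<subseteq> U"
  proof
    fix y assume "y \<in> S"
    then have "(m x2, y) \<in> (Restr R U)\<^sup>*" unfolding S_def by simp
    then show "y \<in> U" by induction (use mU in auto)
  qed
  have reach: "(m x2, y) \<in> (Restr R S)\<^sup>*" if "y \<in> S" for y
  proof -
    have "(m x2, y) \<in> (Restr R U)\<^sup>*" using that unfolding S_def by simp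
    then show ?thesis
    proof induction
      case (step y z)
      then have "y \<in> S" "z \<in> S" unfolding S_def by (auto intro: rtrancl_into_rtrancl)
      then show ?case using step by (auto intro: rtrancl_into_rtrancl)
    qed simp
  qed
  have "sym ((Restr R S)\<^sup>*)" using R.sym_R by (intro sym_rtrancl) (auto simp: sym_def)
  then have conS: "(s, t) \<in> (Restr R S)\<^sup>*" if "s \<in> S" "t \<in> S" for s t
    using reach that by (meson rtrancl_trans symD)
  have "sym ((Restr R (V - {h, m h}))\<^sup>*)" using R.sym_R by (intro sym_rtrancl) (auto simp: sym_def)
  then have "(x2, x1) \<in> (Restr R (V - {h, m h}))\<^sup>*" using x2_in unfolding comp_def by (auto dest: symD)
  moreover have "y \<in> insert x2 S \<or> (\<exists>s\<in>S. (s, x1) \<in> R)"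
    if "(x2, y) \<in> (Restr R (V - {h, m h}))\<^sup>*" for y using that
  proof induction
    case (step y z)
    then show ?case
    proof (elim disjE)
      assume y: "y \<in> insert x2 S"
      have yz: "(y, z) \<in> R" "y \<in> V" "z \<in> V" "z \<noteq> h" "z \<noteq> m h" "z \<noteq> y"
        using step(2) R.irrefl by auto
      show ?thesis
      proof (cases "z = m x2 \<or> z = x2")
        case True
        then show ?thesis using base by blast
      next
        case False
        obtain s where s: "s \<in> S" "(s, z) \<in> R"
        proof (cases "y = x2")
          case True
          then have "(m x2, z) \<in> R" using twin[of x2 z] yz False x2V R.symR by blast
          then show ?thesis using base that by blast
        qed (use y yz that in blast)
        have sU: "s \<in> V" "s \<noteq> x1" "s \<noteq> m x1" using s SU unfolding U_def by auto
        show ?thesis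
        proof (cases "z \<in> {x1, m x1}")
          case True
          then have "(s, x1) \<in> R" using s twin[of x1 s] sU V by blast
          then show ?thesis using s by blast
        next
          case False
          then have "z \<in> U" using yz \<open>\<not> (z = m x2 \<or> z = x2)\<close> unfolding U_def by auto
          then show ?thesis using S_step s SU by blast
        qed
      qed
    qed blast
  qed simp
  ultimately obtain s where s: "s \<in> S" "(s, x1) \<in> R" using SU x2(3) unfolding U_def by blast
  have "(s, m x1) \<in> R" using s twin[of x1 s] SU V unfolding U_def by blast
  moreover have "(m h, x2) \<in> R" using twin[of h x2] x2 ne2 V x2V R.symR by blast
  moreover have "(m x2, x2) \<in> R" using x2m R.symR by blast
  moreover have "distinct [h, m h, x1, m x1, x2]" using ne ne2 x2 by auto
  moreover have "S \<inter> {h, m h, x1, m x1, x2} = {}" using SU unfolding U_def by auto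
  ultimately have "K33_pattern R h (m h) x1 (m x1) x2 S"
    unfolding K33_pattern_def using conS adj x2 s base by blast
  then show False using R.K33_free by blast
qed

lemma same_graph: "R = Q"
  using equal_degrees unequal_degrees same_triples.unequal_degrees[OF swapped] by (metis linorder_neqE_nat)

end

subsection \<open>Connectedness, triples and degrees\<close>

lemma connected_iff_no_closed_set:
  "Digraph_Component.connected H \<longleftrightarrow> verts H \<noteq> {} \<and>
     (\<forall>S \<subseteq> verts H. S \<noteq> {} \<longrightarrow> parcs (mk_symmetric H) `` S \<inter> verts H \<subseteq> S \<longrightarrow> S = verts H)"
  (is "_ \<longleftrightarrow> _ \<and> ?closed")
proof -
  let ?M = "parcs (mk_symmetric H)"
  have "?closed \<longleftrightarrow> (\<forall>x\<in>verts H. \<forall>y\<in>verts H. (x, y) \<in> rtrancl_on (verts H) ?M)"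
  proof
    assume closed: ?closed
    show "\<forall>x\<in>verts H. \<forall>y\<in>verts H. (x, y) \<in> rtrancl_on (verts H) ?M"
    proof
      fix x assume x: "x \<in> verts H"
      let ?S = "{y. (x, y) \<in> rtrancl_on (verts H) ?M}"
      have "?S \<subseteq> verts H" using in_rtrancl_on_in_F(2) by auto
      moreover have "x \<in> ?S" using x by auto
      moreover have "?M `` ?S \<inter> verts H \<subseteq> ?S" by (auto intro: rtrancl_on_into_rtrancl_on)
      ultimately have "?S = verts H" using closed by (metis (no_types, lifting) empty_iff)
      then show "\<forall>y\<in>verts H. (x, y) \<in> rtrancl_on (verts H) ?M" by blast
    qed
  next
    assume reach: "\<forall>x\<in>verts H. \<forall>y\<in>verts H. (x, y) \<in> rtrancl_on (verts H) ?M"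
    show ?closed
    proof (intro allI impI)
      fix S assume S: "S \<subseteq> verts H" "S \<noteq> {}" "?M `` S \<inter> verts H \<subseteq> S"
      obtain x where x: "x \<in> S" using S(2) by blast
      have "y \<in> S" if "(x, y) \<in> rtrancl_on (verts H) ?M" for y
        using that
      proof (induction rule: rtrancl_on_induct)
        case base show ?case by (rule x)
      next
        case (step y z) then show ?case using S(3) by blast
      qed
      then show "S = verts H" using reach S(1) x by blast
    qed
  qed
  then show ?thesis
    unfolding Digraph_Component.connected_def strongly_connected_def reachable_def by simp
qed

context pair_graph begin

lemma sym_parcs: "sym (parcs G)"
  using arcs_symmetric by (auto simp: sym_def)

lemma connected_imp_no_closed_set:
  assumes "Digraph_Component.connected (with_proj G)"
    and "S \<subseteq> pverts G" "S \<noteq> {}" "parcs G `` S \<subseteq> S"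
  shows "S = pverts G"
proof -
  have M: "parcs (mk_symmetric (with_proj G)) = parcs G"
    using sym_parcs by (auto simp: parcs_mk_symmetric sym_def)
  have "\<forall>S \<subseteq> pverts G. S \<noteq> {} \<longrightarrow> parcs G `` S \<inter> pverts G \<subseteq> S \<longrightarrow> S = pverts G"
    using conjunct2[OF iffD1[OF connected_iff_no_closed_set assms(1)]] unfolding M with_proj_simps .
  then show ?thesis using assms(2-4) by (metis le_infI1)
qed

lemma parcs_mk_symmetric_induce_subgraph:
  "parcs (mk_symmetric (with_proj G \<restriction> S)) = Restr (parcs G) S"
  using sym_parcs by (auto simp: parcs_mk_symmetric sym_def)

lemma triple_in_T3:
  assumes "distinct [a, b, c]" "{a, b, c} \<subseteq> pverts G"
  shows "{a, b, c} \<in> T3 G \<longleftrightarrow> majority (parcs G) a b c"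
proof -
  let ?H = "with_proj G \<restriction> {a, b, c}"
  note M = parcs_mk_symmetric_induce_subgraph[of "{a, b, c}"]
  have sym: "(x, y) \<in> parcs G \<longleftrightarrow> (y, x) \<in> parcs G" for x y using symD[OF sym_parcs, of x y] symD[OF sym_parcs, of y x] by (rule iffI)
  have "Digraph_Component.connected ?H \<longleftrightarrow> (\<forall>S \<subseteq> {a, b, c}. S \<noteq> {} \<longrightarrow>
      Restr (parcs G) {a, b, c} `` S \<subseteq> S \<longrightarrow> S = {a, b, c})"
    unfolding connected_iff_no_closed_set M induce_subgraph_verts by blast
  also have "\<dots> \<longleftrightarrow> majority (parcs G) a b c"
  proof
    assume closed: "\<forall>S \<subseteq> {a, b, c}. S \<noteq> {} \<longrightarrow> Restr (parcs G) {a, b, c} `` S \<subseteq> S \<longrightarrow> S = {a, b, c}"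
    have "\<exists>y\<in>{a, b, c} - {x}. (x, y) \<in> parcs G" if "x \<in> {a, b, c}" for x
    proof (rule ccontr)
      assume "\<not> ?thesis"
      then have "Restr (parcs G) {a, b, c} `` {x} \<subseteq> {x}" by auto
      then have "{x} = {a, b, c}" using closed that by auto
      then show False using assms(1) by auto
    qed
    from this[of a] this[of b] this[of c] show "majority (parcs G) a b c"
      unfolding majority_def using sym[of b a] sym[of c a] sym[of c b] by auto
  next
    assume maj: "majority (parcs G) a b c"
    show "\<forall>S \<subseteq> {a, b, c}. S \<noteq> {} \<longrightarrow> Restr (parcs G) {a, b, c} `` S \<subseteq> S \<longrightarrow> S = {a, b, c}"
    proof (intro allI impI)
      fix S assume S: "S \<subseteq> {a, b, c}" "S \<noteq> {}" "Restr (parcs G) {a, b, c} `` S \<subseteq> S"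
      have step: "y \<in> S" if "x \<in> S" "(x, y) \<in> parcs G \<or> (y, x) \<in> parcs G" "y \<in> {a, b, c}" for x y
        using S that sym by blast
      have "a \<in> S \<or> b \<in> S \<or> c \<in> S" using S by blast
      then have "a \<in> S \<and> b \<in> S \<and> c \<in> S"
        using maj step[of a b] step[of b a] step[of a c] step[of c a] step[of b c] step[of c b]
        unfolding majority_def by blast
      then show "S = {a, b, c}" using S(1) by blast
    qed
  qed
  finally show ?thesis using assms unfolding T3_def by auto
qed

lemma Union_T3:
  assumes "Digraph_Component.connected (with_proj G)" "3 \<le> card (pverts G)"
  shows "\<Union>(T3 G) = pverts G"
proof
  show "\<Union>(T3 G) \<subseteq> pverts G" unfolding T3_def by blast
  show "pverts G \<subseteq> \<Union>(T3 G)"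
  proof
    fix x assume x: "x \<in> pverts G"
    have "\<not> parcs G `` {x} \<subseteq> {x}"
    proof
      assume "parcs G `` {x} \<subseteq> {x}"
      then have "pverts G = {x}"
        using connected_imp_no_closed_set[OF assms(1), of "{x}"] x by simp
      then have "card (pverts G) = 1" by simp
      then show False using assms(2) by simp
    qed
    then obtain y where y: "(x, y) \<in> parcs G" "y \<noteq> x" by blast
    then have yV: "y \<in> pverts G" using in_arcsD2 by blast
    have "\<not> parcs G `` {x, y} \<subseteq> {x, y}"
    proof
      assume "parcs G `` {x, y} \<subseteq> {x, y}"
      then have "pverts G = {x, y}"
        using connected_imp_no_closed_set[OF assms(1), of "{x, y}"] x yV by simp
      then have "card (pverts G) = 2" using y by simp
      then show False using assms(2) by simp
    qed
    then obtain z where z: "z \<noteq> x" "z \<noteq> y" "(x, z) \<in> parcs G \<or> (y, z) \<in> parcs G" by blast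
    then have "z \<in> pverts G" using in_arcsD2 by blast
    then have "{x, y, z} \<in> T3 G"
      using triple_in_T3[of x y z] x y yV z unfolding majority_def by auto
    then show "x \<in> \<Union>(T3 G)" by blast
  qed
qed

lemma out_degree_eq_card: "out_degree (with_proj G) v = card (parcs G `` {v})"
proof -
  have "out_arcs (with_proj G) v = Pair v ` (parcs G `` {v})"
    by (auto simp: out_arcs_def)
  then show ?thesis unfolding out_degree_def by (simp add: card_image inj_on_def)
qed

lemma planar_regular_K33_free:
  assumes "Digraph_Component.connected (with_proj G)" "regular G" "planar G" "7 \<le> card (pverts G)"
  obtains d where "regular_K33_free (pverts G) (parcs G) d"
proof -
  obtain d where "\<forall>v\<in>pverts G. out_degree (with_proj G) v = d"
    using assms(2) unfolding regular_def by blast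
  moreover have "\<not> K33_pattern (parcs G) u v a b c S" for u v a b c S
    using planar_no_K33_pattern[OF _ assms(3)] by blast
  moreover have "(x, x) \<notin> parcs G" for x using no_loops' by blast
  ultimately have "regular_K33_free (pverts G) (parcs G) d"
    using assms(4) connected_imp_no_closed_set[OF assms(1)] sym_parcs in_arcsD1 in_arcsD2
    by unfold_locales (auto simp: out_degree_eq_card)
  then show thesis by (rule that)
qed

end

theorem theorem3p12:
  shows "T3_reconstructible
    {G :: 'a pair_pre_digraph. pair_graph G \<and> Digraph_Component.connected (with_proj G) \<and>
       regular G \<and> planar G \<and> card (pverts G) \<ge> 7}"
proof -
  have "G = H"
    if G: "pair_graph G" "Digraph_Component.connected (with_proj G)" "regular G" "planar G"
        "7 \<le> card (pverts G)"
      and H: "pair_graph H" "Digraph_Component.connected (with_proj H)" "regular H" "planar H"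
        "7 \<le> card (pverts H)"
      and T3: "T3 G = T3 H" for G H :: "'a pair_pre_digraph"
  proof -
    interpret G: pair_graph G by fact
    interpret H: pair_graph H by fact
    have V: "pverts G = pverts H"
      using G.Union_T3[OF G(2)] H.Union_T3[OF H(2)] G(5) H(5) T3 by simp
    obtain d where d: "regular_K33_free (pverts G) (parcs G) d"
      using G.planar_regular_K33_free[OF G(2-5)] .
    obtain e where e: "regular_K33_free (pverts G) (parcs H) e"
      using H.planar_regular_K33_free[OF H(2-5)] unfolding V .
    have "same_triples (pverts G) (parcs G) d (parcs H) e"
    proof (intro same_triples.intro same_triples_axioms.intro d e)
      fix a b c assume abc: "distinct [a, b, c]" "{a, b, c} \<subseteq> pverts G"
      show "majority (parcs G) a b c = majority (parcs H) a b c"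
        using G.triple_in_T3[OF abc] H.triple_in_T3[OF abc[unfolded V]] T3 by simp
    qed
    then have "parcs G = parcs H" by (rule same_triples.same_graph)
    then show "G = H" using V by simp
  qed
  then show ?thesis unfolding T3_reconstructible_def by blast
qed

end
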